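(* Let $s\geq 2$ be an integer. If $\alpha\in(0,s-1]\cap\mathbb{Q}$, or $\alpha=s-1+\frac{1}{k}$ for some positive integer $k$, then the random $s$-hypergraph $G^{s}(n,n^{-\alpha})$ does not obey the Zero-One Law.
   Context: An $s$-uniform hypergraph (or $s$-hypergraph) is a pair $(V,E)$ where $V$ is a set of vertices and $E$ is a set of edges, each edge being a set of exactly $s$ elements of $V$. For $p=p(n)\in[0,1]$, $G^{s}(n,p)$ denotes the binomial random $s$-hypergraph on the vertex set $\{1,\dots,n\}$: each of the $\binom{n}{s}$ possible edges is included independently with probability $p$. First-order properties of $s$-hypergraphs are those expressed by a first-order sentence in the language with equality and one $s$-ary relation symbol, interpreted as "$x_1,\dots,x_s$ are distinct and $\{x_1,\dots,x_s\}$ is an edge", with variables ranging over vertices. A property $A$ holds almost surely if $\lim_{n\to\infty}\Pr[G^{s}(n,p(n))\models A]=1$, and almost never if $\lim_{n\to\infty}\Pr[G^{s}(n,p(n))\models A]=0$. The random $s$-hypergraph $G^{s}(n,p(n))$ obeys the Zero-One Law if every first-order property holds almost surely or almost never. *)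

theory Defs
  imports "HOL-Probability.Probability"
begin

type_synonym 'a hypergraph = "'a set \<times> 'a set set"

definition uniform_hypergraph :: "nat \<Rightarrow> 'a hypergraph \<Rightarrow> bool" where
  "uniform_hypergraph s H \<longleftrightarrow> (\<forall>e\<in>snd H. e \<subseteq> fst H \<and> finite e \<and> card e = s)"

(* First-order formulas with variables named by natural numbers; the other connectives and the
   universal quantifier are definable from the ones below. *)
datatype fo_formula =
    Equal nat nat
  | Rel "nat list"
  | Neg fo_formula
  | Conj fo_formula fo_formula
  | Exi nat fo_formula

fun free_vars :: "fo_formula \<Rightarrow> nat set" where
  "free_vars (Equal x y) = {x, y}"
| "free_vars (Rel xs) = set xs"
| "free_vars (Neg \<phi>) = free_vars \<phi>"
| "free_vars (Conj \<phi> \<psi>) = free_vars \<phi> \<union> free_vars \<psi>"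
| "free_vars (Exi x \<phi>) = free_vars \<phi> - {x}"

fun has_arity :: "nat \<Rightarrow> fo_formula \<Rightarrow> bool" where
  "has_arity s (Equal x y) \<longleftrightarrow> True"
| "has_arity s (Rel xs) \<longleftrightarrow> length xs = s"
| "has_arity s (Neg \<phi>) \<longleftrightarrow> has_arity s \<phi>"
| "has_arity s (Conj \<phi> \<psi>) \<longleftrightarrow> has_arity s \<phi> \<and> has_arity s \<psi>"
| "has_arity s (Exi x \<phi>) \<longleftrightarrow> has_arity s \<phi>"

definition fo_sentence :: "nat \<Rightarrow> fo_formula \<Rightarrow> bool" where
  "fo_sentence s \<phi> \<longleftrightarrow> has_arity s \<phi> \<and> free_vars \<phi> = {}"

fun satisfies :: "'a hypergraph \<Rightarrow> (nat \<Rightarrow> 'a) \<Rightarrow> fo_formula \<Rightarrow> bool" where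
  "satisfies H \<sigma> (Equal x y) \<longleftrightarrow> \<sigma> x = \<sigma> y"
| "satisfies H \<sigma> (Rel xs) \<longleftrightarrow> distinct (map \<sigma> xs) \<and> set (map \<sigma> xs) \<in> snd H"
| "satisfies H \<sigma> (Neg \<phi>) \<longleftrightarrow> \<not> satisfies H \<sigma> \<phi>"
| "satisfies H \<sigma> (Conj \<phi> \<psi>) \<longleftrightarrow> satisfies H \<sigma> \<phi> \<and> satisfies H \<sigma> \<psi>"
| "satisfies H \<sigma> (Exi x \<phi>) \<longleftrightarrow> (\<exists>v\<in>fst H. satisfies H (\<sigma>(x := v)) \<phi>)"

lemma satisfies_cong:
  "(\<And>x. x \<in> free_vars \<phi> \<Longrightarrow> \<sigma> x = \<tau> x) \<Longrightarrow> satisfies H \<sigma> \<phi> \<longleftrightarrow> satisfies H \<tau> \<phi>"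
proof (induction \<phi> arbitrary: \<sigma> \<tau>)
  case (Rel xs)
  then have "map \<sigma> xs = map \<tau> xs" by simp
  then show ?case by (simp only: satisfies.simps)
next
  case (Neg \<phi>)
  then show ?case by (metis free_vars.simps(3) satisfies.simps(3))
next
  case (Conj \<phi> \<psi>)
  then show ?case by (metis UnCI free_vars.simps(4) satisfies.simps(4))
next
  case (Exi x \<phi>)
  have "satisfies H (\<sigma>(x := v)) \<phi> \<longleftrightarrow> satisfies H (\<tau>(x := v)) \<phi>" for v
    by (rule Exi.IH) (use Exi.prems in auto)
  then show ?case by simp
qed simp

(* For a sentence the choice of the assignment is immaterial, see sentence_models_iff. *)
definition models :: "'a hypergraph \<Rightarrow> fo_formula \<Rightarrow> bool" where
  "models H \<phi> \<longleftrightarrow> (\<forall>\<sigma>. satisfies H \<sigma> \<phi>)"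

lemma sentence_models_iff:
  assumes "fo_sentence s \<phi>"
  shows "models H \<phi> \<longleftrightarrow> satisfies H \<sigma> \<phi>"
  using assms satisfies_cong[of \<phi>] unfolding models_def fo_sentence_def by blast

definition possible_edges :: "nat \<Rightarrow> nat \<Rightarrow> nat set set" where
  "possible_edges s n = {e. e \<subseteq> {1..n} \<and> card e = s}"

definition random_hypergraph :: "nat \<Rightarrow> nat \<Rightarrow> real \<Rightarrow> nat hypergraph pmf" where
  "random_hypergraph s n p =
     map_pmf (\<lambda>f. ({1..n}, {e \<in> possible_edges s n. f e}))
       (Pi_pmf (possible_edges s n) False (\<lambda>_. bernoulli_pmf p))"

lemma uniform_random_hypergraph:
  assumes "H \<in> set_pmf (random_hypergraph s n p)"
  shows "uniform_hypergraph s H"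
proof -
  obtain f where H: "H = ({1..n}, {e \<in> possible_edges s n. f e})"
    using assms unfolding random_hypergraph_def set_map_pmf by blast
  have "e \<subseteq> {1..n} \<and> finite e \<and> card e = s" if "e \<in> possible_edges s n" for e
    using that finite_subset[of e "{1..n}"] unfolding possible_edges_def by blast
  then show ?thesis unfolding uniform_hypergraph_def H by simp
qed

definition first_order_property :: "nat \<Rightarrow> nat hypergraph set \<Rightarrow> bool" where
  "first_order_property s A \<longleftrightarrow>
     (\<exists>\<phi>. fo_sentence s \<phi> \<and> (\<forall>H. uniform_hypergraph s H \<longrightarrow> (H \<in> A \<longleftrightarrow> models H \<phi>)))"

definition holds_almost_surely :: "nat \<Rightarrow> (nat \<Rightarrow> real) \<Rightarrow> nat hypergraph set \<Rightarrow> bool" where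
  "holds_almost_surely s p A \<longleftrightarrow>
     (\<lambda>n. measure_pmf.prob (random_hypergraph s n (p n)) A) \<longlonglongrightarrow> 1"

definition holds_almost_never :: "nat \<Rightarrow> (nat \<Rightarrow> real) \<Rightarrow> nat hypergraph set \<Rightarrow> bool" where
  "holds_almost_never s p A \<longleftrightarrow>
     (\<lambda>n. measure_pmf.prob (random_hypergraph s n (p n)) A) \<longlonglongrightarrow> 0"

definition zero_one_law :: "nat \<Rightarrow> (nat \<Rightarrow> real) \<Rightarrow> bool" where
  "zero_one_law s p \<longleftrightarrow>
     (\<forall>A. first_order_property s A \<longrightarrow> holds_almost_surely s p A \<or> holds_almost_never s p A)"

end

(*
  Write \<alpha> = a / b. Suppose H is a hypergraph with v vertices and e edges such that v = \<alpha> * e and every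
  vertex set S spans at most |S| / \<alpha> edges, and that H has a nontrivial automorphism. Let X be the
  number of embeddings of H into the random hypergraph. Then E X <= n^v * n^(- \<alpha> * e) = 1, and
  embeddings come in at least pairs, so P(X > 0) <= 1/2. Balancedness bounds the joint probability
  of two embeddings g and h by n^(|g(V) \<inter> h(V)| - 2 * v), hence E X^2 <= (v + 1)^v, and the second moment
  method bounds P(X > 0) away from 0. So containing H is a first-order property violating the law.

  All the exponents admit a representation with s <= a <= (s - 1) * b + 1, and such an H then exists:
  let each vertex carry b units and each edge consume the a units of one block of consecutive units.
*)
theory Submission
  imports Defs
begin

section \<open>Containment as a first-order sentence\<close>

text \<open>Functions are extensional so that the set is finite for finite \<open>V\<close> and
  \<open>X\<close> and two distinct embeddings differ at a point of \<open>V\<close>. Edges are left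
  out: whether they are preserved is the random event.\<close>

definition embeddings :: "'a set \<Rightarrow> 'b set \<Rightarrow> ('a \<Rightarrow> 'b) set" where
  "embeddings V X = {g \<in> V \<rightarrow>\<^sub>E X. inj_on g V}"

lemma finite_embeddings: "finite V \<Longrightarrow> finite X \<Longrightarrow> finite (embeddings V X)"
  unfolding embeddings_def by (simp add: finite_PiE)

(* The empty conjunction has to be a closed tautology that also holds in the empty structure. *)
fun conj_list :: "fo_formula list \<Rightarrow> fo_formula" where
  "conj_list [] = Neg (Exi 0 (Neg (Equal 0 0)))"
| "conj_list (\<phi> # \<phi>s) = Conj \<phi> (conj_list \<phi>s)"

fun exi_list :: "nat list \<Rightarrow> fo_formula \<Rightarrow> fo_formula" where
  "exi_list [] \<phi> = \<phi>"
| "exi_list (x # xs) \<phi> = Exi x (exi_list xs \<phi>)"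

lemma free_vars_conj_list: "free_vars (conj_list \<phi>s) = (\<Union>\<phi>\<in>set \<phi>s. free_vars \<phi>)"
  by (induction \<phi>s) auto

lemma free_vars_exi_list: "free_vars (exi_list xs \<phi>) = free_vars \<phi> - set xs"
  by (induction xs) auto

lemma has_arity_conj_list: "has_arity s (conj_list \<phi>s) \<longleftrightarrow> (\<forall>\<phi>\<in>set \<phi>s. has_arity s \<phi>)"
  by (induction \<phi>s) auto

lemma has_arity_exi_list: "has_arity s (exi_list xs \<phi>) \<longleftrightarrow> has_arity s \<phi>"
  by (induction xs) auto

lemma satisfies_conj_list:
  "satisfies H \<sigma> (conj_list \<phi>s) \<longleftrightarrow> (\<forall>\<phi>\<in>set \<phi>s. satisfies H \<sigma> \<phi>)"
  by (induction \<phi>s) auto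

lemma satisfies_exi_list:
  "satisfies H \<sigma> (exi_list xs \<phi>) \<longleftrightarrow>
     (\<exists>\<tau>. (\<forall>x\<in>set xs. \<tau> x \<in> fst H) \<and> (\<forall>x. x \<notin> set xs \<longrightarrow> \<tau> x = \<sigma> x) \<and> satisfies H \<tau> \<phi>)"
proof (induction xs arbitrary: \<sigma>)
  case Nil
  have "\<tau> = \<sigma>" if "\<forall>x. \<tau> x = \<sigma> x" for \<tau>
    using that by auto
  then show ?case by auto
next
  case (Cons x xs)
  show ?case (is "?L \<longleftrightarrow> ?R")
  proof
    assume ?L
    then obtain v \<tau> where v: "v \<in> fst H" "\<forall>y\<in>set xs. \<tau> y \<in> fst H"
      "\<forall>y. y \<notin> set xs \<longrightarrow> \<tau> y = (\<sigma>(x := v)) y" "satisfies H \<tau> \<phi>"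
      using Cons.IH by auto
    \<comment> \<open>If \<open>x\<close> occurs again in \<open>xs\<close>, an inner quantifier
      overrides \<open>v\<close>, so \<open>\<tau> x\<close> may differ from
      \<open>v\<close>.\<close>
    have "\<tau> x \<in> fst H" using v by (cases "x \<in> set xs") auto
    with v show ?R by (intro exI[of _ \<tau>]) auto
  next
    assume ?R
    then obtain \<tau> where t: "\<forall>y\<in>set (x # xs). \<tau> y \<in> fst H"
      "\<forall>y. y \<notin> set (x # xs) \<longrightarrow> \<tau> y = \<sigma> y" "satisfies H \<tau> \<phi>" by blast
    then have "satisfies H (\<sigma>(x := \<tau> x)) (exi_list xs \<phi>)"
      by (subst Cons.IH) (intro exI[of _ \<tau>], auto)
    then show ?L using t(1) by auto
  qed
qed

text \<open>The vertices themselves serve as variables through \<open>to_nat\<close>, hence the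
  countable type. Disequalities force an assignment to be injective on them, and one atom per edge
  forces the edges. An edge may be listed in any order, since \<open>Rel\<close> depends only on the
  set of its distinct arguments.\<close>

lemma containment_sentence:
  fixes V :: "'a::countable set"
  assumes fin: "finite V" and unif: "uniform_hypergraph s (V, E)"
  obtains \<phi> where "fo_sentence s \<phi>"
    "\<And>H. models H \<phi> \<longleftrightarrow> (\<exists>g\<in>embeddings V (fst H). \<forall>e\<in>E. g ` e \<in> snd H)"
proof -
  have E: "e \<subseteq> V" "finite e" "card e = s" if "e \<in> E" for e
    using unif that unfolding uniform_hypergraph_def by auto
  have "finite E"
    by (rule finite_subset[of _ "Pow V"]) (use E(1) fin in auto)
  then obtain es where es: "set es = E" using finite_list by blast
  obtain vs where vs: "set vs = V" using finite_list[OF fin] by blast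
  have "\<exists>l. set l = e \<and> distinct l" if "e \<in> E" for e
    using finite_distinct_list[OF E(2)[OF that]] .
  then obtain l where l: "\<And>e. e \<in> E \<Longrightarrow> set (l e) = e \<and> distinct (l e)"
    by metis
  define \<psi>s where "\<psi>s = [Neg (Equal (to_nat x) (to_nat y)). x \<leftarrow> vs, y \<leftarrow> vs, x \<noteq> y]
    @ [Rel (map to_nat (l e)). e \<leftarrow> es]"
  define \<phi> where "\<phi> = exi_list (map to_nat vs) (conj_list \<psi>s)"
  have "length (l e) = s" if "e \<in> E" for e
    using E(3) l that by (metis distinct_card)
  then have "has_arity s \<phi>"
    unfolding \<phi>_def \<psi>s_def has_arity_exi_list has_arity_conj_list by (auto simp: es)
  moreover have "free_vars \<phi> = {}"
    unfolding \<phi>_def \<psi>s_def free_vars_exi_list free_vars_conj_list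
    using l E(1) by (fastforce simp: es vs)
  ultimately have sent: "fo_sentence s \<phi>" by (simp add: fo_sentence_def)
  have "models H \<phi> \<longleftrightarrow> (\<exists>g\<in>embeddings V (fst H). \<forall>e\<in>E. g ` e \<in> snd H)" for H :: "'b hypergraph"
  proof -
    have body: "satisfies H \<tau> (conj_list \<psi>s) \<longleftrightarrow>
        inj_on (\<tau> \<circ> to_nat) V \<and> (\<forall>e\<in>E. (\<tau> \<circ> to_nat) ` e \<in> snd H)" for \<tau>
    proof -
      have "satisfies H \<tau> (conj_list \<psi>s) \<longleftrightarrow> inj_on (\<tau> \<circ> to_nat) V \<and>
        (\<forall>e\<in>E. distinct (map (\<tau> \<circ> to_nat) (l e)) \<and> (\<tau> \<circ> to_nat) ` set (l e) \<in> snd H)"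
        unfolding \<psi>s_def satisfies_conj_list set_append ball_Un
        by (simp add: es vs inj_on_def image_comp) blast
      moreover have "distinct (map (\<tau> \<circ> to_nat) (l e))" if "inj_on (\<tau> \<circ> to_nat) V" "e \<in> E" for e
        using l[OF that(2)] E(1)[OF that(2)] that(1) by (metis distinct_map inj_on_subset)
      ultimately show ?thesis using l by auto
    qed
    have "models H \<phi> \<longleftrightarrow> (\<exists>\<tau>. (\<forall>x\<in>V. \<tau> (to_nat x) \<in> fst H) \<and>
        (\<forall>y. y \<notin> to_nat ` V \<longrightarrow> \<tau> y = undefined) \<and>
        inj_on (\<tau> \<circ> to_nat) V \<and> (\<forall>e\<in>E. (\<tau> \<circ> to_nat) ` e \<in> snd H))"
      unfolding sentence_models_iff[OF sent, of H "\<lambda>_. undefined"]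
      unfolding \<phi>_def satisfies_exi_list body by (simp add: vs)
    also have "\<dots> \<longleftrightarrow> (\<exists>g\<in>embeddings V (fst H). \<forall>e\<in>E. g ` e \<in> snd H)" (is "?L \<longleftrightarrow> ?R")
    proof
      assume ?L
      then obtain \<tau> where t: "\<forall>x\<in>V. \<tau> (to_nat x) \<in> fst H"
        "inj_on (\<tau> \<circ> to_nat) V" "\<forall>e\<in>E. (\<tau> \<circ> to_nat) ` e \<in> snd H" by blast
      have "restrict (\<tau> \<circ> to_nat) V ` e = (\<tau> \<circ> to_nat) ` e" if "e \<in> E" for e
        using E(1)[OF that] by (intro image_cong) auto
      with t show ?R
        by (intro bexI[of _ "restrict (\<tau> \<circ> to_nat) V"]) (auto simp: embeddings_def inj_on_def)
    next
      assume ?R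
      then obtain g where g: "g \<in> embeddings V (fst H)" "\<forall>e\<in>E. g ` e \<in> snd H" by blast
      \<comment> \<open>Off the quantified variables the assignment has to agree with the constant
        assignment \<open>undefined\<close> at which the sentence is evaluated.\<close>
      define \<tau> where "\<tau> = (\<lambda>y. if y \<in> to_nat ` V then g (from_nat y) else undefined)"
      have tg: "(\<tau> \<circ> to_nat) x = g x" if "x \<in> V" for x
        using that by (simp add: \<tau>_def)
      have "(\<tau> \<circ> to_nat) ` e = g ` e" if "e \<in> E" for e
        using E(1)[OF that] tg by (intro image_cong) auto
      moreover have "inj_on (\<tau> \<circ> to_nat) V"
        using g(1) inj_on_cong[of V "\<tau> \<circ> to_nat" g] tg by (auto simp: embeddings_def)
      moreover have "\<forall>x\<in>V. \<tau> (to_nat x) \<in> fst H"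
        using g(1) tg by (auto simp: embeddings_def)
      moreover have "\<forall>y. y \<notin> to_nat ` V \<longrightarrow> \<tau> y = undefined"
        by (simp add: \<tau>_def)
      ultimately show ?L using g(2) by (intro exI[of _ \<tau>]) simp
    qed
    finally show ?thesis .
  qed
  with sent show thesis by (rule that)
qed

section \<open>First and second moment bounds\<close>

text \<open>Let X count the events that occur and let U be their union. As X vanishes off U,
  expanding the expectation of the square of X - 2 * K * 1_U gives 0 \<le> K - 2 * K + 4 * K^2 *
  P(U).\<close>

lemma (in prob_space) prob_UN_ge_second_moment:
  assumes fin: "finite I" and ev: "\<And>i. i \<in> I \<Longrightarrow> A i \<in> events" and "K > 0"
    and first: "1 / 2 \<le> (\<Sum>i\<in>I. prob (A i))"
    and second: "(\<Sum>i\<in>I. \<Sum>j\<in>I. prob (A i \<inter> A j)) \<le> K"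
  shows "1 / (4 * K) \<le> prob (\<Union>i\<in>I. A i)"
proof -
  let ?U = "\<Union>i\<in>I. A i"
  let ?X = "\<lambda>\<omega>. (\<Sum>i\<in>I. indicator (A i) \<omega>) :: real"
  have U: "?U \<in> events" using fin ev by blast
  have int: "integrable M (indicator B :: _ \<Rightarrow> real)" if "B \<in> events" for B
    using that by (simp add: integrable_real_indicator emeasure_eq_measure)
  \<comment> \<open>A coefficient c in place of 2 * K would give P(U) \<ge> (c - K) / c^2, which is
    largest at c = 2 * K.\<close>
  have sq: "(?X \<omega> - 2 * K * indicator ?U \<omega>)\<^sup>2 = (\<Sum>i\<in>I. \<Sum>j\<in>I. indicator (A i \<inter> A j) \<omega>)
      - 4 * K * ?X \<omega> + 4 * K\<^sup>2 * indicator ?U \<omega>" for \<omega>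
  proof -
    have "?X \<omega> * ?X \<omega> = (\<Sum>i\<in>I. \<Sum>j\<in>I. indicator (A i \<inter> A j) \<omega>)"
      by (simp add: sum_product indicator_inter_arith)
    moreover have "?X \<omega> * indicator ?U \<omega> = ?X \<omega>"
      by (auto simp: sum_distrib_right intro!: sum.cong split: split_indicator)
    moreover have "indicator ?U \<omega> * indicator ?U \<omega> = (indicator ?U \<omega> :: real)"
      by (simp split: split_indicator)
    moreover have "(x - 2 * K * u)\<^sup>2 = x * x - 4 * K * (x * u) + 4 * K\<^sup>2 * (u * u)" for x u :: real
      by (simp add: power2_eq_square algebra_simps)
    ultimately show ?thesis by metis
  qed
  have "0 \<le> expectation (\<lambda>\<omega>. (?X \<omega> - 2 * K * indicator ?U \<omega>)\<^sup>2)"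
    by simp
  also have "\<dots> = (\<Sum>i\<in>I. \<Sum>j\<in>I. prob (A i \<inter> A j)) - 4 * K * (\<Sum>i\<in>I. prob (A i)) + 4 * K\<^sup>2 * prob ?U"
    unfolding sq using ev U by (simp add: int)
  also have "\<dots> \<le> K - 4 * K * (1 / 2) + 4 * K\<^sup>2 * prob ?U"
    using first second \<open>K > 0\<close> by (intro add_mono diff_mono mult_left_mono) auto
  finally have "K * 1 \<le> K * (4 * K * prob ?U)" by (simp add: power2_eq_square algebra_simps)
  then have "1 \<le> 4 * K * prob ?U" using \<open>K > 0\<close> by simp
  then show ?thesis using \<open>K > 0\<close> by (simp add: field_simps)
qed

text \<open>An outcome in the union lies in at least two of the events, so twice the indicator of
  the union is at most the number of events that occur. Taking expectations gives the bound.\<close>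

lemma (in prob_space) prob_UN_le_half:
  assumes fin: "finite I" and ev: "\<And>i. i \<in> I \<Longrightarrow> A i \<in> events"
    and twin: "\<And>i. i \<in> I \<Longrightarrow> \<exists>j\<in>I. j \<noteq> i \<and> A j = A i"
    and first: "(\<Sum>i\<in>I. prob (A i)) \<le> 1"
  shows "prob (\<Union>i\<in>I. A i) \<le> 1 / 2"
proof -
  let ?U = "\<Union>i\<in>I. A i"
  have U: "?U \<in> events" using fin ev by blast
  have int: "integrable M (indicator B :: _ \<Rightarrow> real)" if "B \<in> events" for B
    using that by (simp add: integrable_real_indicator emeasure_eq_measure)
  have pt: "2 * indicator ?U \<omega> \<le> (\<Sum>i\<in>I. indicator (A i) \<omega> :: real)" for \<omega>
  proof (cases "\<omega> \<in> ?U")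
    case True
    then obtain i where i: "i \<in> I" "\<omega> \<in> A i" by blast
    with twin obtain j where j: "j \<in> I" "j \<noteq> i" "\<omega> \<in> A j" by metis
    have "2 = (\<Sum>k\<in>{i, j}. indicator (A k) \<omega> :: real)" using i j by simp
    also have "\<dots> \<le> (\<Sum>k\<in>I. indicator (A k) \<omega>)" using i j fin by (intro sum_mono2) auto
    finally show ?thesis using True by simp
  qed (simp add: sum_nonneg)
  have "2 * prob ?U = expectation (\<lambda>\<omega>. 2 * indicator ?U \<omega>)"
    using U by (simp add: int)
  also have "\<dots> \<le> expectation (\<lambda>\<omega>. \<Sum>i\<in>I. indicator (A i) \<omega>)"
    using U ev by (intro integral_mono pt) (auto simp: int)
  also have "\<dots> = (\<Sum>i\<in>I. prob (A i))"
    using ev by (simp add: int)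
  finally show ?thesis using first by simp
qed

lemma prob_Pi_pmf_bernoulli_all:
  assumes "finite A" "F \<subseteq> A" "0 \<le> p" "p \<le> 1"
  shows "measure_pmf.prob (Pi_pmf A False (\<lambda>_. bernoulli_pmf p)) {f. \<forall>e\<in>F. f e} = p ^ card F"
proof -
  let ?B = "\<lambda>x. if x \<in> F then {True} else UNIV"
  have "{f. \<forall>e\<in>F. f e} = Pi A ?B"
    using assms(2) by (auto simp: Pi_iff split: if_splits)
  then have "measure_pmf.prob (Pi_pmf A False (\<lambda>_. bernoulli_pmf p)) {f. \<forall>e\<in>F. f e} =
      (\<Prod>x\<in>A. measure_pmf.prob (bernoulli_pmf p) (?B x))"
    using assms(1) by (simp add: measure_Pi_pmf_Pi)
  also have "\<dots> = (\<Prod>x\<in>A. if x \<in> F then p else 1)"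
    using assms(3,4) by (intro prod.cong) (auto simp: measure_pmf_single)
  also have "\<dots> = p ^ card F"
    using assms(1,2) by (simp add: prod.If_cases Int_absorb1)
  finally show ?thesis .
qed

text \<open>With v = |V|, the count is a falling factorial, at least (n - v)^v = n^v * (1 - v/n)^v.
  Bernoulli's inequality bounds the last factor below by 1 - v^2/n, which is at least 1/2.\<close>

lemma card_embeddings_ge:
  fixes n :: nat
  assumes fin: "finite V" and n: "2 * (card V)\<^sup>2 \<le> n" and "n > 0"
  shows "1 / 2 * real n ^ card V \<le> real (card (embeddings V {1..n}))"
proof -
  define v where "v = card V"
  have vn: "v \<le> n"
    using n by (metis v_def le_trans mult_le_cancel2 power2_eq_square le_square le_add1 mult_2)
  have "2 * real (v * v) \<le> real n"
    using n unfolding v_def power2_eq_square by (metis of_nat_le_iff of_nat_mult of_nat_numeral)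
  then have "1 / 2 \<le> 1 + real v * (- (real v / real n))"
    using \<open>n > 0\<close> by (simp add: field_simps)
  also have "\<dots> \<le> (1 + - (real v / real n)) ^ v"
    using vn \<open>n > 0\<close> by (intro Bernoulli_inequality) simp
  finally have "1 / 2 * real n ^ v \<le> (1 - real v / real n) ^ v * real n ^ v"
    by (intro mult_right_mono) auto
  also have "\<dots> = (real n - real v) ^ v"
    using \<open>n > 0\<close> by (simp add: power_mult_distrib[symmetric] field_simps)
  also have "\<dots> = (\<Prod>i\<in>{0..<v}. real (n - v))"
    using vn by (simp add: of_nat_diff)
  also have "\<dots> \<le> (\<Prod>i\<in>{0..<v}. real (n - i))"
    by (intro prod_mono) auto
  also have "\<dots> = real (card (embeddings V {1..n}))"
    unfolding embeddings_def using card_inj_on_subset_funcset[OF fin, of "{1..n}" V] by (simp add: v_def)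
  finally show ?thesis by (simp add: v_def)
qed

section \<open>Failure of the law at the critical exponent of a balanced hypergraph\<close>

locale balanced_hypergraph =
  fixes V :: "'a::countable set" and E :: "'a set set" and s :: nat and \<alpha> :: real and \<rho> :: "'a \<Rightarrow> 'a"
  assumes finite_V: "finite V"
    and uniform: "uniform_hypergraph s (V, E)"
    and density: "real (card V) = \<alpha> * real (card E)"
    and balanced: "F \<subseteq> E \<Longrightarrow> S \<subseteq> V \<Longrightarrow> \<Union>F \<subseteq> S \<Longrightarrow> \<alpha> * real (card F) \<le> real (card S)"
    and pos: "\<alpha> > 0"
    and automorphism: "bij_betw \<rho> V V" "(`) \<rho> ` E = E"
    and nontrivial: "\<exists>x\<in>V. \<rho> x \<noteq> x"
begin

lemma edge_subset: "e \<in> E \<Longrightarrow> e \<subseteq> V"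
  and edge_card: "e \<in> E \<Longrightarrow> card e = s"
  using uniform by (auto simp: uniform_hypergraph_def)

lemma finite_E: "finite E"
  by (rule finite_subset[of _ "Pow V"]) (use edge_subset finite_V in auto)

definition contained :: "('a \<Rightarrow> nat) \<Rightarrow> (nat set \<Rightarrow> bool) set" where
  "contained g = {f. \<forall>e\<in>E. f (g ` e)}"

definition rand :: "nat \<Rightarrow> (nat set \<Rightarrow> bool) pmf" where
  "rand n = Pi_pmf (possible_edges s n) False (\<lambda>_. bernoulli_pmf (real n powr (- \<alpha>)))"

lemma finite_possible_edges: "finite (possible_edges s n)"
  by (rule finite_subset[of _ "Pow {1..n}"]) (auto simp: possible_edges_def)

lemma image_possible_edge:
  assumes "g \<in> embeddings V {1..n}" "e \<in> E"
  shows "g ` e \<in> possible_edges s n"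
proof -
  have "inj_on g e"
    using assms edge_subset[OF assms(2)] by (auto simp: embeddings_def intro: inj_on_subset)
  then show ?thesis
    using assms edge_subset[OF assms(2)] edge_card[OF assms(2)]
    by (auto simp: embeddings_def possible_edges_def card_image)
qed

lemma card_image_edges:
  assumes "g \<in> embeddings V X" "F \<subseteq> E"
  shows "card ((`) g ` F) = card F"
proof (rule card_image)
  have "inj_on ((`) g) (Pow V)"
    using assms(1) by (intro inj_on_image_Pow) (simp add: embeddings_def)
  then show "inj_on ((`) g) F"
    using assms(2) edge_subset by (auto intro: inj_on_subset)
qed

lemma prob_rand_all:
  assumes "n > 0" "F \<subseteq> possible_edges s n"
  shows "measure_pmf.prob (rand n) {f. \<forall>e\<in>F. f e} = real n powr (- \<alpha> * real (card F))"
proof -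
  have "measure_pmf.prob (rand n) {f. \<forall>e\<in>F. f e} = (real n powr (- \<alpha>)) ^ card F"
    unfolding rand_def using assms pos
    by (intro prob_Pi_pmf_bernoulli_all finite_possible_edges)
       (auto simp: powr_minus field_simps ge_one_powr_ge_zero)
  then show ?thesis
    using assms(1) by (simp add: powr_power mult.commute)
qed

lemma contained_eq: "contained g = {f. \<forall>e\<in>(`) g ` E. f e}"
  by (simp add: contained_def)

text \<open>An embedding maps distinct edges to distinct edges, and \<open>density\<close> turns the
  exponent -\<alpha> * |E| into -|V|.\<close>

lemma prob_contained:
  assumes "n > 0" "g \<in> embeddings V {1..n}"
  shows "measure_pmf.prob (rand n) (contained g) = 1 / real n ^ card V"
proof -
  have "measure_pmf.prob (rand n) (contained g) = real n powr (- real (card V))"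
    unfolding contained_eq density using assms image_possible_edge card_image_edges[OF assms(2)]
    by (subst prob_rand_all) auto
  then show ?thesis
    using assms(1) by (simp add: powr_minus powr_realpow divide_simps)
qed

text \<open>The edges common to both copies are the \<open>g\<close>-images of a set
  \<open>F\<close> of edges, and all vertices of \<open>F\<close> lie in the set \<open>S\<close> of
  vertices that \<open>g\<close> sends into the image of \<open>h\<close>. The union has 2 * |E| -
  |F| edges, and \<open>balanced\<close> gives \<alpha> * |F| \<le> |S|, so n^(|S| - 2 * |V|) is an
  upper bound. Writing n^|S| as a product over vertices prepares the summation over
  \<open>g\<close>.\<close>

lemma prob_contained_pair:
  assumes n: "n > 0" and g: "g \<in> embeddings V {1..n}" and h: "h \<in> embeddings V {1..n}"
  shows "measure_pmf.prob (rand n) (contained g \<inter> contained h)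
    \<le> (\<Prod>x\<in>V. if g x \<in> h ` V then real n else 1) / real n ^ (2 * card V)"
proof -
  let ?G = "(`) g ` E" and ?H = "(`) h ` E"
  define F where "F = {e\<in>E. g ` e \<in> ?H}"
  define S where "S = {x\<in>V. g x \<in> h ` V}"
  have "?G \<inter> ?H = (`) g ` F" unfolding F_def by auto
  then have "card (?G \<inter> ?H) = card F"
    using card_image_edges[OF g, of F] by (simp add: F_def)
  then have "real (card E) + real (card E) = real (card (?G \<union> ?H)) + real (card F)"
    using card_Un_Int[of ?G ?H] card_image_edges[OF g] card_image_edges[OF h] finite_E by simp
  then have c: "- \<alpha> * real (card (?G \<union> ?H)) = \<alpha> * real (card F) - 2 * (\<alpha> * real (card E))"
    by (simp add: algebra_simps)
  have "\<Union>F \<subseteq> S"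
    using edge_subset unfolding F_def S_def by fastforce
  then have le: "\<alpha> * real (card F) \<le> real (card S)"
    by (intro balanced) (auto simp: F_def S_def)
  have "contained g \<inter> contained h = {f. \<forall>e\<in>?G \<union> ?H. f e}"
    by (auto simp: contained_def)
  then have "measure_pmf.prob (rand n) (contained g \<inter> contained h) =
      real n powr (- \<alpha> * real (card (?G \<union> ?H)))"
    using n image_possible_edge g h by (simp only:) (rule prob_rand_all, auto)
  also have "\<dots> \<le> real n powr (real (card S) - real (2 * card V))"
    unfolding c using n le density by (intro powr_mono) auto
  also have "\<dots> = real n ^ card S / real n ^ (2 * card V)"
    unfolding powr_diff using n by (simp only: powr_realpow of_nat_0_less_iff)
  also have "real n ^ card S = (\<Prod>x\<in>V. if g x \<in> h ` V then real n else 1)"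
    using finite_V unfolding S_def by (simp add: prod.If_cases Int_def conj_commute)
  finally show ?thesis .
qed

text \<open>Put v = |V|. For fixed \<open>h\<close>, letting \<open>g\<close> range over all
  functions turns the sum of products into a product of v equal sums. In each sum at most v values
  lie in the image of \<open>h\<close> and weigh n, the others weigh 1, so it is at most (v + 1) *
  n. The n^v choices of \<open>h\<close> then cancel the remaining powers of n.\<close>

lemma second_moment:
  assumes n: "n > 0"
  shows "(\<Sum>h\<in>embeddings V {1..n}. \<Sum>g\<in>embeddings V {1..n}.
    measure_pmf.prob (rand n) (contained h \<inter> contained g)) \<le> (real (card V) + 1) ^ card V"
proof -
  let ?Fun = "V \<rightarrow>\<^sub>E {1..n}" and ?v = "card V"
  let ?w = "\<lambda>h y. if y \<in> h ` V then real n else 1"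
  have fin: "finite ?Fun" using finite_V by (simp add: finite_PiE)
  have sub: "embeddings V {1..n} \<subseteq> ?Fun" by (auto simp: embeddings_def)
  have inner: "(\<Sum>g\<in>?Fun. \<Prod>x\<in>V. ?w h (g x)) \<le> ((real ?v + 1) * real n) ^ ?v" for h
  proof -
    have "(\<Sum>y\<in>{1..n}. ?w h y) \<le> (real ?v + 1) * real n"
    proof -
      have "(\<Sum>y\<in>{1..n}. ?w h y) \<le> (\<Sum>y\<in>{1..n}. (if y \<in> h ` V then real n else 0) + 1)"
        by (intro sum_mono) auto
      also have "\<dots> = real (card ({1..n} \<inter> h ` V)) * real n + real n"
        by (simp only: sum.distrib) (simp add: sum.If_cases)
      also have "card ({1..n} \<inter> h ` V) \<le> ?v"
        using finite_V by (meson card_image_le card_mono finite_imageI inf_le2 le_trans)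
      finally show ?thesis by (simp add: algebra_simps mult_right_mono)
    qed
    then have "(\<Prod>x\<in>V. \<Sum>y\<in>{1..n}. ?w h y) \<le> (\<Prod>x\<in>V. (real ?v + 1) * real n)"
      by (intro prod_mono) (auto intro!: sum_nonneg)
    also have "(\<Prod>x\<in>V. \<Sum>y\<in>{1..n}. ?w h y) = (\<Sum>g\<in>?Fun. \<Prod>x\<in>V. ?w h (g x))"
      using finite_V by (subst prod_sum_PiE) auto
    finally show ?thesis by simp
  qed
  have "(\<Sum>h\<in>embeddings V {1..n}. \<Sum>g\<in>embeddings V {1..n}.
      measure_pmf.prob (rand n) (contained h \<inter> contained g))
    \<le> (\<Sum>h\<in>embeddings V {1..n}. \<Sum>g\<in>embeddings V {1..n}.
      (\<Prod>x\<in>V. ?w h (g x)) / real n ^ (2 * ?v))"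
    by (intro sum_mono, subst Int_commute) (rule prob_contained_pair[OF n])
  also have "\<dots> \<le> (\<Sum>h\<in>?Fun. \<Sum>g\<in>?Fun. (\<Prod>x\<in>V. ?w h (g x)) / real n ^ (2 * ?v))"
    by (intro order_trans[OF sum_mono sum_mono2] sum_mono2 fin sub sum_nonneg divide_nonneg_nonneg prod_nonneg) auto
  also have "\<dots> \<le> (\<Sum>h\<in>?Fun. ((real ?v + 1) * real n) ^ ?v / real n ^ (2 * ?v))"
    unfolding sum_divide_distrib[symmetric] by (intro divide_right_mono sum_mono inner) auto
  also have "\<dots> = (real ?v + 1) ^ ?v"
    unfolding power_mult_distrib mult_2 power_add using n finite_V by (simp add: card_funcsetE)
  finally show ?thesis .
qed

lemma prob_contained_some_ge:
  assumes "n > 0" "2 * (card V)\<^sup>2 \<le> n"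
  shows "1 / (4 * (real (card V) + 1) ^ card V) \<le>
    measure_pmf.prob (rand n) (\<Union>g\<in>embeddings V {1..n}. contained g)"
proof (rule measure_pmf.prob_UN_ge_second_moment)
  show "finite (embeddings V {1..n})"
    using finite_V by (simp add: finite_embeddings)
  show "1 / 2 \<le> (\<Sum>g\<in>embeddings V {1..n}. measure_pmf.prob (rand n) (contained g))"
    using card_embeddings_ge[OF finite_V assms(2,1)] assms(1)
    by (simp add: prob_contained field_simps)
qed (use second_moment[OF assms(1)] in auto)

lemma prob_contained_some_le:
  assumes n: "n > 0"
  shows "measure_pmf.prob (rand n) (\<Union>g\<in>embeddings V {1..n}. contained g) \<le> 1 / 2"
proof (rule measure_pmf.prob_UN_le_half)
  show "finite (embeddings V {1..n})"
    using finite_V by (simp add: finite_embeddings)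
  have "card (embeddings V {1..n}) \<le> card (V \<rightarrow>\<^sub>E {1..n})"
    using finite_V by (intro card_mono) (auto simp: embeddings_def finite_PiE)
  then have "real (card (embeddings V {1..n})) \<le> real n ^ card V"
    using finite_V by (simp add: card_funcsetE flip: of_nat_power)
  then show "(\<Sum>g\<in>embeddings V {1..n}. measure_pmf.prob (rand n) (contained g)) \<le> 1"
    using n by (simp add: prob_contained)
next
  fix g assume g: "g \<in> embeddings V {1..n}"
  \<comment> \<open>The twin of \<open>g\<close>: composing with the automorphism permutes the
    edges, so the image of \<open>E\<close> is unchanged, while injectivity of \<open>g\<close>
    makes the two maps differ wherever \<open>\<rho>\<close> moves a vertex.\<close>
  define h where "h = restrict (g \<circ> \<rho>) V"
  have rho: "\<rho> ` V = V" "inj_on \<rho> V"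
    using automorphism(1) by (auto simp: bij_betw_def)
  have "inj_on (g \<circ> \<rho>) V"
    using g rho by (intro comp_inj_on) (auto simp: embeddings_def)
  moreover have "h \<in> V \<rightarrow>\<^sub>E {1..n}"
    using g rho(1) by (fastforce simp: embeddings_def h_def)
  ultimately have h: "h \<in> embeddings V {1..n}"
    by (simp add: embeddings_def h_def)
  obtain x where x: "x \<in> V" "\<rho> x \<noteq> x" using nontrivial by blast
  have "\<rho> x \<in> V" using x rho(1) by blast
  then have "h x \<noteq> g x"
    using x g by (auto simp: h_def embeddings_def inj_on_def)
  moreover have "contained h = contained g"
  proof -
    have "h ` e = g ` \<rho> ` e" if "e \<in> E" for e
      using edge_subset[OF that] by (auto simp: h_def)
    then have "(`) h ` E = (\<lambda>e. g ` \<rho> ` e) ` E"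
      by (rule image_cong[OF refl])
    also have "\<dots> = (`) g ` (`) \<rho> ` E"
      by (rule image_image[symmetric])
    finally show ?thesis
      unfolding contained_eq automorphism(2) by simp
  qed
  ultimately show "\<exists>h\<in>embeddings V {1..n}. h \<noteq> g \<and> contained h = contained g"
    using h by auto
qed simp

text \<open>For all large n the probability of containment lies between a fixed positive constant
  and 1/2, which excludes both limits.\<close>

theorem not_zero_one_law: "\<not> zero_one_law s (\<lambda>n. real n powr (- \<alpha>))"
proof
  assume law: "zero_one_law s (\<lambda>n. real n powr (- \<alpha>))"
  obtain \<phi> where sent: "fo_sentence s \<phi>" and
    mod: "\<And>H :: nat hypergraph. models H \<phi> \<longleftrightarrow> (\<exists>g\<in>embeddings V (fst H). \<forall>e\<in>E. g ` e \<in> snd H)"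
    using containment_sentence[OF finite_V uniform] by blast
  define P where "P n = measure_pmf.prob (random_hypergraph s n (real n powr (- \<alpha>)))
    {H. models H \<phi>}" for n
  have P: "P n = measure_pmf.prob (rand n) (\<Union>g\<in>embeddings V {1..n}. contained g)" for n
  proof -
    have "(\<lambda>f. ({1..n}, {e \<in> possible_edges s n. f e})) -` {H. models H \<phi>} =
        (\<Union>g\<in>embeddings V {1..n}. contained g)"
      using image_possible_edge by (auto simp: mod contained_def)
    then show ?thesis
      by (simp add: P_def random_hypergraph_def rand_def)
  qed
  define c where "c = 1 / (4 * (real (card V) + 1) ^ card V)"
  have "c > 0" unfolding c_def by (intro divide_pos_pos mult_pos_pos zero_less_power) auto
  have ge: "\<forall>\<^sub>F n in sequentially. c \<le> P n"
    using eventually_gt_at_top[of 0] eventually_ge_at_top[of "2 * (card V)\<^sup>2"]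
    unfolding P c_def by eventually_elim (rule prob_contained_some_ge)
  have le: "\<forall>\<^sub>F n in sequentially. P n \<le> 1 / 2"
    using eventually_gt_at_top[of 0] by eventually_elim (simp only: P prob_contained_some_le)
  have "first_order_property s {H. models H \<phi>}"
    using sent unfolding first_order_property_def by auto
  then have "P \<longlonglongrightarrow> 1 \<or> P \<longlonglongrightarrow> 0"
    using law unfolding zero_one_law_def holds_almost_surely_def holds_almost_never_def P_def by blast
  then show False
    using tendsto_upperbound[OF _ le, of 1] tendsto_lowerbound[OF _ ge, of 0] \<open>c > 0\<close> by auto
qed

end

section \<open>Balanced hypergraphs of prescribed density\<close>

text \<open>Polymorphic because it acts both on vertices and on the index triples of edges.\<close>

definition rotate_layer :: "'a \<times> nat \<times> 'b \<Rightarrow> 'a \<times> nat \<times> 'b" where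
  "rotate_layer = (\<lambda>(i, t, c). (i, (t + 1) mod 3, c))"

lemma rotate_layer_image: "rotate_layer ` (A \<times> {..<3} \<times> B) = A \<times> {..<3} \<times> B"
proof
  show "rotate_layer ` (A \<times> {..<3} \<times> B) \<subseteq> A \<times> {..<3} \<times> B"
    by (auto simp: rotate_layer_def)
  show "A \<times> {..<3} \<times> B \<subseteq> rotate_layer ` (A \<times> {..<3} \<times> B)"
  proof
    fix p assume "p \<in> A \<times> {..<3::nat} \<times> B"
    then obtain i t c where p: "p = (i, t, c)" "i \<in> A" "t < 3" "c \<in> B" by auto
    then have "p = rotate_layer (i, (t + 2) mod 3, c)"
      by (simp add: rotate_layer_def mod_simps)
    then show "p \<in> rotate_layer ` (A \<times> {..<3} \<times> B)"
      by (rule image_eqI) (use p in auto)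
  qed
qed

locale interval_hypergraph =
  fixes a b s :: nat
  assumes b_pos: "b > 0" and s_ge: "s \<ge> 2" and a_ge: "s \<le> a" and a_le: "a \<le> (s - 1) * b + 1"
begin

(* Vertex i of a layer owns the units u with u div b = i, so a layer has a * b units. Its b cores
   come from cutting these units into b blocks of length a; by a \<le> (s - 1) * b + 1 a block meets
   at most s vertices. *)
definition core :: "nat \<Rightarrow> nat set" where
  "core j = (\<lambda>u. u div b) ` {j * a..<(j + 1) * a}"

(* Layers are pairs (t, c). A core in layer (t, c) is padded up to s vertices from layer (t + 1, j)
   modulo 3; the cyclic direction tells the core from the padding and hence keeps edges distinct. *)
definition edge :: "nat \<Rightarrow> nat \<Rightarrow> nat \<Rightarrow> (nat \<times> nat \<times> nat) set" where
  "edge j t c = core j \<times> {(t, c)} \<union> {..<s - card (core j)} \<times> {((t + 1) mod 3, j)}"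

text \<open>In a triple (j, t, c), j numbers the block and (t, c) the layer. With c ranging over b
  values, every block number j names a padding layer. The 3 * b * b index triples against 3 * a * b
  vertices give the ratio a / b.\<close>

definition indices :: "(nat \<times> nat \<times> nat) set" where
  "indices = {..<b} \<times> {..<3} \<times> {..<b}"

definition vertices :: "(nat \<times> nat \<times> nat) set" where
  "vertices = {..<a} \<times> {..<3} \<times> {..<b}"

definition edges :: "(nat \<times> nat \<times> nat) set set" where
  "edges = (\<lambda>(j, t, c). edge j t c) ` indices"

lemma a_pos: "a > 0"
  using s_ge a_ge by simp

section \<open>Sizes and coincidences of cores\<close>

lemma finite_core: "finite (core j)"
  by (simp add: core_def)

lemma core_nonempty: "core j \<noteq> {}"
  using a_pos by (simp add: core_def)

lemma core_subset: "j < b \<Longrightarrow> core j \<subseteq> {..<a}"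
proof
  fix x assume "j < b" "x \<in> core j"
  then obtain u where u: "x = u div b" "u < (j + 1) * a"
    by (auto simp: core_def)
  have "(j + 1) * a \<le> b * a" using \<open>j < b\<close> by (intro mult_right_mono) auto
  then show "x \<in> {..<a}"
    using u by (simp add: less_mult_imp_div_less mult.commute)
qed

lemma card_core_le: "card (core j) \<le> s"
proof -
  have "core j \<subseteq> {j * a div b..<j * a div b + s}"
  proof
    fix x assume "x \<in> core j"
    then obtain u where u: "x = u div b" "j * a \<le> u" "u < (j + 1) * a"
      by (auto simp: core_def)
    \<comment> \<open>The strict bound on u absorbs the summand 1 in \<open>a_le\<close>.\<close>
    have "u \<le> j * a + (s - 1) * b" using u(3) a_le by simp
    then have "x \<le> (j * a + (s - 1) * b) div b" using u(1) by (simp add: div_le_mono)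
    then have "x \<le> j * a div b + (s - 1)" using b_pos by simp
    moreover have "j * a div b \<le> x" using u by (simp add: div_le_mono)
    ultimately show "x \<in> {j * a div b..<j * a div b + s}" using s_ge by auto
  qed
  from card_mono[OF _ this] show ?thesis by simp
qed

text \<open>Owners increase weakly with units, so no vertex of an earlier core exceeds a vertex of a
  later one. If the two cores coincide, any two of their vertices are equal.\<close>

lemma card_core_le_1:
  assumes "core j = core j'" "j < j'"
  shows "card (core j) \<le> 1"
proof -
  have "x \<le> y" if "x \<in> core j" "y \<in> core j'" for x y
  proof -
    obtain u w where u: "x = u div b" "u < (j + 1) * a" and w: "y = w div b" "j' * a \<le> w"
      using \<open>x \<in> core j\<close> \<open>y \<in> core j'\<close> by (auto simp: core_def)
    have "(j + 1) * a \<le> j' * a" using assms(2) by (intro mult_right_mono) auto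
    with u w show ?thesis by (simp add: div_le_mono)
  qed
  then have "x = y" if "x \<in> core j" "y \<in> core j" for x y
    using that assms(1) by (simp add: order_antisym)
  then show ?thesis
    using finite_core by (simp add: card_le_Suc0_iff_eq)
qed

text \<open>Full cores have no padding to record j, but they have s \<ge> 2 vertices and so cannot
  coincide for different blocks.\<close>

lemma core_inj:
  assumes "core j = core j'" "card (core j) = s"
  shows "j = j'"
  using card_core_le_1[of j j'] card_core_le_1[of j' j] assms s_ge
  by (metis One_nat_def Suc_1 linorder_less_linear not_less_eq_eq)

lemma mod3_neq: "t < 3 \<Longrightarrow> (t + 1) mod 3 \<noteq> (t::nat)"
  "t < 3 \<Longrightarrow> ((t + 1) mod 3 + 1) mod 3 \<noteq> (t::nat)"
  by presburger+

text \<open>If the layers differed, the nonempty core of each edge would lie in the padding of the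
  other, so t = t' + 1 and t' = t + 1 modulo 3. This is impossible modulo 3, though not modulo
  2.\<close>

lemma edge_determines_layer:
  assumes "t < 3" "t' < 3" and eq: "edge j t c = edge j' t' c'"
  shows "t = t' \<and> c = c'"
proof -
  have *: "(t, c) = (t', c') \<or> t = (t' + 1) mod 3" if "edge j t c = edge j' t' c'" for j t c j' t' c'
  proof -
    obtain x where "x \<in> core j" using core_nonempty by blast
    then have "(x, t, c) \<in> edge j' t' c'" unfolding that[symmetric] by (simp add: edge_def)
    then show ?thesis by (auto simp: edge_def)
  qed
  show ?thesis
    using *[OF eq] *[OF eq[symmetric]] assms(1,2) mod3_neq by (metis prod.inject)
qed

text \<open>Once the layer is known, j is read off from the layer of the padding if there is any,
  and from the core by \<open>core_inj\<close> otherwise.\<close>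

lemma edge_inj:
  assumes t: "t < 3" "t' < 3" and eq: "edge j t c = edge j' t' c'"
  shows "j = j' \<and> t = t' \<and> c = c'"
proof -
  have tc: "t' = t" "c' = c" using edge_determines_layer[OF assms] by auto
  have *: "j = j'" if "card (core j) < s" "edge j t c = edge j' t c" for j j'
  proof -
    have "(0, (t + 1) mod 3, j) \<in> edge j' t c"
      unfolding that(2)[symmetric] using that(1) by (simp add: edge_def)
    then show ?thesis using mod3_neq(1)[OF t(1)] by (auto simp: edge_def)
  qed
  have "core j = {x. (x, t, c) \<in> edge j t c}" for j
    using mod3_neq(1)[OF t(1)] by (auto simp: edge_def)
  then have "core j = core j'" using eq tc by simp
  then have "j = j'"
    using *[of j j'] core_inj[of j j'] eq tc card_core_le[of j] by fastforce
  then show ?thesis using tc by simp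
qed

lemma inj_on_edge: "inj_on (\<lambda>(j, t, c). edge j t c) indices"
proof (rule inj_onI)
  fix p q assume "p \<in> indices" "q \<in> indices"
    "(\<lambda>(j, t, c). edge j t c) p = (\<lambda>(j, t, c). edge j t c) q"
  then show "p = q"
    using edge_inj by (cases p; cases q) (auto simp: indices_def)
qed

lemma card_edge: "t < 3 \<Longrightarrow> card (edge j t c) = s"
  unfolding edge_def using mod3_neq(1)[of t] card_core_le[of j] finite_core
  by (subst card_Un_disjoint) (auto simp: card_cartesian_product)

lemma edge_subset_vertices:
  assumes "j < b" "t < 3" "c < b"
  shows "edge j t c \<subseteq> vertices"
proof -
  \<comment> \<open>A nonempty core leaves fewer than s padding vertices, and a layer has a \<ge> s
    vertices to supply them.\<close>
  have "card (core j) > 0" using core_nonempty finite_core by (simp add: card_gt_0_iff)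
  then show ?thesis
    using assms core_subset[OF assms(1)] a_ge by (fastforce simp: edge_def vertices_def)
qed

(* Counts the pairs (edge of F, unit of its core) against the pairs (vertex of S, one of its b units). *)
lemma edges_balanced:
  assumes F: "F \<subseteq> edges" and S: "S \<subseteq> vertices" and sub: "\<Union>F \<subseteq> S"
  shows "card F * a \<le> card S * b"
proof -
  obtain T where T: "T \<subseteq> indices" "F = (\<lambda>(j, t, c). edge j t c) ` T"
    using F unfolding edges_def by (meson subset_image_iff)
  have "card F = card T"
    unfolding T(2) using inj_on_edge T(1) by (intro card_image) (rule inj_on_subset)
  moreover have "card (T \<times> {..<a}) \<le> card (S \<times> {..<b})"
  proof (rule card_inj_on_le)
    \<comment> \<open>Unit k of block j is the unit j * a + k of the layer. Its quotient and
      remainder by b are its owner and its place there. They determine the unit, whose quotient and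
      remainder by a return j and k.\<close>
    let ?f = "\<lambda>((j, t, c), k). (((j * a + k) div b, t, c), (j * a + k) mod b)"
    show "inj_on ?f (T \<times> {..<a})"
    proof (rule inj_onI, clarsimp)
      fix j t c k j' t' c' k' :: nat
      assume k: "k < a" "k' < a"
        and "(j * a + k) div b = (j' * a + k') div b" "(j * a + k) mod b = (j' * a + k') mod b"
      then have eq: "j * a + k = j' * a + k'" by (metis mult_div_mod_eq)
      then have "(j * a + k) div a = (j' * a + k') div a" by simp
      then have "j = j'" using k by simp
      then show "j = j' \<and> k = k'" using eq by simp
    qed
    show "?f ` (T \<times> {..<a}) \<subseteq> S \<times> {..<b}"
    proof clarsimp
      fix j t c k assume p: "(j, t, c) \<in> T" "k < a"
      have "(j * a + k) div b \<in> core j"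
        unfolding core_def using p(2) by (intro imageI) auto
      then have "((j * a + k) div b, t, c) \<in> edge j t c" by (simp add: edge_def)
      moreover have "edge j t c \<subseteq> S" using p(1) sub T(2) by force
      ultimately show "((j * a + k) div b, t, c) \<in> S \<and> (j * a + k) mod b < b"
        using b_pos by auto
    qed
    have "finite vertices" by (simp add: vertices_def)
    then show "finite (S \<times> {..<b})"
      using S by (auto intro: finite_subset)
  qed
  ultimately show ?thesis by (simp add: card_cartesian_product)
qed

text \<open>The padding layer is placed relative to t, so a cyclic shift carries core and padding
  along together.\<close>

lemma rotate_edge: "t < 3 \<Longrightarrow> rotate_layer ` edge j t c = edge j ((t + 1) mod 3) c"
  by (force simp: edge_def rotate_layer_def)

sublocale balanced_hypergraph vertices edges s "real a / real b" rotate_layer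
proof
  show "finite vertices" by (simp add: vertices_def)
  then have "finite e" if "e \<subseteq> vertices" for e using that by (rule rev_finite_subset)
  then show "uniform_hypergraph s (vertices, edges)"
    using edge_subset_vertices card_edge
    by (fastforce simp: uniform_hypergraph_def edges_def indices_def)
  show "real (card vertices) = real a / real b * real (card edges)"
    unfolding edges_def card_image[OF inj_on_edge] using b_pos
    by (simp add: vertices_def indices_def card_cartesian_product)
  show "real a / real b * real (card F) \<le> real (card S)"
    if "F \<subseteq> edges" "S \<subseteq> vertices" "\<Union>F \<subseteq> S" for F S
  proof -
    have "real (card F) * real a \<le> real (card S) * real b"
      using edges_balanced[OF that] by (metis of_nat_le_iff of_nat_mult)
    then show ?thesis using b_pos by (simp add: field_simps)
  qed
  show "real a / real b > 0" using a_pos b_pos by simp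
  have img: "rotate_layer ` vertices = vertices"
    unfolding vertices_def by (rule rotate_layer_image)
  then show "bij_betw rotate_layer vertices vertices"
    using \<open>finite vertices\<close> by (simp add: bij_betw_def eq_card_imp_inj_on)
  have "(`) rotate_layer ` edges =
      (\<lambda>p. rotate_layer ` (\<lambda>(j, t, c). edge j t c) p) ` indices"
    unfolding edges_def by (rule image_image)
  also have "\<dots> = (\<lambda>p. (\<lambda>(j, t, c). edge j t c) (rotate_layer p)) ` indices"
  proof (rule image_cong[OF refl])
    fix p assume "p \<in> indices"
    then show "rotate_layer ` (\<lambda>(j, t, c). edge j t c) p = (\<lambda>(j, t, c). edge j t c) (rotate_layer p)"
      by (cases p) (simp add: indices_def rotate_edge, simp add: rotate_layer_def)
  qed
  also have "\<dots> = (\<lambda>(j, t, c). edge j t c) ` rotate_layer ` indices"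
    by (rule image_image[symmetric])
  also have "rotate_layer ` indices = indices"
    unfolding indices_def by (rule rotate_layer_image)
  finally show "(`) rotate_layer ` edges = edges" by (simp only: edges_def)
  show "\<exists>x\<in>vertices. rotate_layer x \<noteq> x"
    using a_pos b_pos by (intro bexI[of _ "(0, 0, 0)"]) (auto simp: rotate_layer_def vertices_def)
qed

end

theorem theorem7:
  fixes s :: nat and \<alpha> :: real
  assumes "s \<ge> 2"
    and "(\<alpha> \<in> {0<..real s - 1} \<and> \<alpha> \<in> \<rat>) \<or> (\<exists>k::nat. k > 0 \<and> \<alpha> = real s - 1 + 1 / real k)"
  shows "\<not> zero_one_law s (\<lambda>n. real n powr (- \<alpha>))"
proof -
  have "\<exists>a b. interval_hypergraph a b s \<and> \<alpha> = real a / real b"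
    using assms(2)
  proof (elim disjE conjE exE)
    assume \<alpha>: "\<alpha> \<in> {0<..real s - 1}" "\<alpha> \<in> \<rat>"
    then obtain m n :: nat where n: "n \<noteq> 0" "\<alpha> = real m / real n"
      by (metis Rats_abs_nat_div_natE abs_of_pos greaterThanAtMost_iff)
    then have "m > 0" using \<alpha>(1) by (cases m) auto
    have "real m \<le> (real s - 1) * real n" using \<alpha>(1) n by (simp add: field_simps)
    also have "\<dots> = real ((s - 1) * n)" using assms(1) by (simp add: of_nat_diff)
    finally have "m \<le> (s - 1) * n" by (simp only: of_nat_le_iff)
    \<comment> \<open>Scaling numerator and denominator by s keeps the quotient and ensures s \<le>
      a, since m is positive.\<close>
    then have "m * s \<le> (s - 1) * (n * s)" by (metis mult.assoc mult_le_mono1)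
    then have "interval_hypergraph (m * s) (n * s) s"
      using assms(1) n(1) \<open>m > 0\<close> by unfold_locales (auto intro: le_SucI)
    moreover have "\<alpha> = real (m * s) / real (n * s)" using n assms(1) by simp
    ultimately show ?thesis by blast
  next
    fix k :: nat assume k: "k > 0" "\<alpha> = real s - 1 + 1 / real k"
    \<comment> \<open>Here a = (s - 1) * k + 1 attains equality in \<open>a_le\<close> with b = k,
      and k \<ge> 1 gives s \<le> a.\<close>
    have "(s - 1) * 1 \<le> (s - 1) * k" using k(1) by (intro mult_left_mono) auto
    then have "interval_hypergraph ((s - 1) * k + 1) k s"
      using assms(1) k(1) by unfold_locales linarith+
    moreover have "\<alpha> = real ((s - 1) * k + 1) / real k"
      using k assms(1) by (simp add: field_simps of_nat_diff)
    ultimately show ?thesis by blast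
  qed
  then obtain a b where "interval_hypergraph a b s" and \<alpha>: "\<alpha> = real a / real b" by blast
  then interpret interval_hypergraph a b s by simp
  show ?thesis unfolding \<alpha> by (rule not_zero_one_law)
qed

end
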